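(* Let $M$ be a proper metric space, $(X,\mathcal E)$ be a coarse space, $\bar X:=h_M(X,\mathcal E)$ be the $M$-compactification of $(X,\mathcal E)$, $G:=G_{X,\bar X}$ be the permutation group of $\bar X$, and $\mathcal E_G$ be the coarse structure on $X$ generated by the action of the group $G$. (1) If $(X,\mathcal E)$ is finitary, then $\mathcal E\subseteq\mathcal E_G$. (2) If $(X,\mathcal E)$ is metrizable and $M$-normal, then $\mathcal E_G\subseteq\mathcal E$. (3) If $(X,\mathcal E)$ is finitary, metrizable and $M$-normal, then $\mathcal E=\mathcal E_G$.
   Context: An entourage on a set $X$ is a subset $E\subseteq X\times X$ containing the diagonal $\Delta_X$; $E^{-1}=\{(y,x):(x,y)\in E\}$, $E\circ F=\{(x,z):\exists y\in X,\ (x,y)\in E,\ (y,z)\in F\}$, $E[x]=\{y\in X:(x,y)\in E\}$, $E[A]=\bigcup_{a\in A}E[a]$. A coarse space $(X,\mathcal E)$ is a set $X$ with a family $\mathcal E$ of entourages (its coarse structure) such that $\bigcup\mathcal E=X\times X$; for all $E,F\in\mathcal E$ there is $G\in\mathcal E$ with $E\circ F^{-1}\subseteq G$; and $\Delta_X\subseteq E\subseteq F\in\mathcal E$ implies $E\in\mathcal E$. A set $B\subseteq X$ is bounded if $B\subseteq E[x]$ for some $E\in\mathcal E$, $x\in X$. The coarse space is finitary if $\sup_{x\in X}|E[x]|$ is finite for every $E\in\mathcal E$. It is metrizable if there is a metric $d$ on $X$ such that $\mathcal E$ consists of all entourages contained in $\{(x,y):d(x,y)\le n\}$ for some $n\in\omega$.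 A metric space $(M,d_M)$ is proper if $|M|\ge 2$ and each closed bounded set in $M$ is compact. A function $\varphi:X\to M$ is slowly oscillating if for every $\varepsilon>0$ and $E\in\mathcal E$ there is a bounded set $B\subseteq X$ with $\mathrm{diam}\,\varphi(E[x])<\varepsilon$ for all $x\in X\setminus B$. Let $\mathsf{so}(X,\mathcal E;M)$ be the set of all bounded slowly oscillating functions $X\to M$. Subsets $A,B\subseteq X$ are asymptotically separated if $E[A]\cap E[B]$ is bounded for every $E\in\mathcal E$. The coarse space is $M$-normal if for any disjoint asymptotically separated nonempty sets $A,B\subseteq X$ there is a slowly oscillating function $\varphi:X\to M$ with $\inf\{d_M(\varphi(a),\varphi(b)):a\in A,\ b\in B\}>0$. The map $\delta_M:X\to M^{\mathsf{so}(X,\mathcal E;M)}$, $x\mapsto(f(x))_{f}$, is injective, and the $M$-compactification $h_M(X,\mathcal E)$ is the closure of $\delta_M(X)$ in $M^{\mathsf{so}(X,\mathcal E;M)}$ (product topology); it is a compact Hausdorff space. $X$ is identified with $\delta_M(X)$, and it is then the set of isolated points of $h_M(X,\mathcal E)$. For a compact Hausdorff space $K$ with set $X$ of isolated points, $\mathcal H(K,X)$ is the group of homeomorphisms $g$ of $K$ with $g(x)=x$ for all $x\in K\setminus X$, and the permutation group of $K$ is $G_{X,K}=\{g{\restriction}X:g\in\mathcal H(K,X)\}$, a subgroup of the group of permutations of $X$. For a group $G$ of permutations of $X$, $\mathcal E_G$ consists of all entourages on $X$ contained in $E_F:=\{(x,y)\in X\times X:y\in\{x\}\cup\{g(x):g\in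 F\}\}$ for some finite $F\subseteq G$.
   Formalization: In the definition of M-normal the separating slowly oscillating function is required to be bounded; if unbounded ones are allowed, (2) and (3) fail, e.g. for X = ℕ with the usual metric and M = {(ln k, j/k) : k ≥ 1, 0 ≤ j ≤ k} in the plane. *)

theory Defs
  imports "HOL-Analysis.Analysis"
begin

text \<open>
  A metric space \<open>M\<close> is a type of class \<open>metric_space\<close>, passed to the notions depending on it as
  an argument of type \<open>'m itself\<close>. The underlying set \<open>X\<close> of a coarse space is a set, and the
  functions on it are the ones that are extensional on \<open>X\<close>. With \<open>E \<subseteq> X \<times> X\<close>, the ball
  \<open>E[x]\<close> is \<open>E `` {x}\<close>, the neighbourhood \<open>E[A]\<close> is \<open>E `` A\<close>, and the composition (left factor
  applied first) is \<open>E O F\<close>.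
\<close>

definition proper_metric_space :: "'m::metric_space itself \<Rightarrow> bool" where
  "proper_metric_space M \<longleftrightarrow>
     (\<exists>a b::'m. a \<noteq> b) \<and> (\<forall>S::'m set. closed S \<and> bounded S \<longrightarrow> compact S)"


subsection \<open>Coarse spaces\<close>

definition entourage :: "'a set \<Rightarrow> ('a \<times> 'a) set \<Rightarrow> bool" where
  "entourage X E \<longleftrightarrow> Id_on X \<subseteq> E \<and> E \<subseteq> X \<times> X"

definition coarse_space :: "'a set \<Rightarrow> ('a \<times> 'a) set set \<Rightarrow> bool" where
  "coarse_space X \<E> \<longleftrightarrow>
     (\<forall>E\<in>\<E>. entourage X E) \<and>
     \<Union>\<E> = X \<times> X \<and>
     (\<forall>E\<in>\<E>. \<forall>F\<in>\<E>. \<exists>G\<in>\<E>. E O F\<inverse> \<subseteq> G) \<and>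
     (\<forall>E F. Id_on X \<subseteq> E \<and> E \<subseteq> F \<and> F \<in> \<E> \<longrightarrow> E \<in> \<E>)"

definition coarse_bounded :: "'a set \<Rightarrow> ('a \<times> 'a) set set \<Rightarrow> 'a set \<Rightarrow> bool" where
  "coarse_bounded X \<E> B \<longleftrightarrow> B \<subseteq> X \<and> (\<exists>E\<in>\<E>. \<exists>x\<in>X. B \<subseteq> E `` {x})"

definition finitary :: "'a set \<Rightarrow> ('a \<times> 'a) set set \<Rightarrow> bool" where
  "finitary X \<E> \<longleftrightarrow> (\<forall>E\<in>\<E>. \<exists>n. \<forall>x\<in>X. finite (E `` {x}) \<and> card (E `` {x}) \<le> n)"

definition coarsely_metrizable :: "'a set \<Rightarrow> ('a \<times> 'a) set set \<Rightarrow> bool" where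
  "coarsely_metrizable X \<E> \<longleftrightarrow>
     (\<exists>d. Metric_space X d \<and>
          \<E> = {E. entourage X E \<and> (\<exists>n::nat. E \<subseteq> {(x, y). d x y \<le> real n})})"

definition asymptotically_separated ::
    "'a set \<Rightarrow> ('a \<times> 'a) set set \<Rightarrow> 'a set \<Rightarrow> 'a set \<Rightarrow> bool" where
  "asymptotically_separated X \<E> A B \<longleftrightarrow> (\<forall>E\<in>\<E>. coarse_bounded X \<E> (E `` A \<inter> E `` B))"


subsection \<open>Slowly oscillating functions\<close>

text \<open>
  The library's \<open>diameter\<close> is real-valued and has no meaningful value on unbounded sets, whose
  diameter is infinite; hence the explicit boundedness condition.
\<close>

definition slowly_oscillating ::
    "'a set \<Rightarrow> ('a \<times> 'a) set set \<Rightarrow> ('a \<Rightarrow> 'm::metric_space) \<Rightarrow> bool" where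
  "slowly_oscillating X \<E> \<phi> \<longleftrightarrow>
     (\<forall>\<epsilon>>0. \<forall>E\<in>\<E>. \<exists>B. coarse_bounded X \<E> B \<and>
        (\<forall>x\<in>X - B. bounded (\<phi> ` (E `` {x})) \<and> diameter (\<phi> ` (E `` {x})) < \<epsilon>))"

definition so ::
    "'m::metric_space itself \<Rightarrow> 'a set \<Rightarrow> ('a \<times> 'a) set set \<Rightarrow> ('a \<Rightarrow> 'm) set" where
  "so M X \<E> = {\<phi> \<in> X \<rightarrow>\<^sub>E UNIV. bounded (\<phi> ` X) \<and> slowly_oscillating X \<E> \<phi>}"

text \<open>
  The separating function is required to be bounded, that is, to be one of the functions that
  define the compactification; for bounded \<open>M\<close> this is automatic. If unbounded
  separating functions were allowed, normality would say nothing about the compactification: for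
  \<open>M = {(ln k, j/k) | 1 \<le> k, 0 \<le> j \<le> k}\<close> in the plane and \<open>X\<close> the natural numbers with the
  usual metric, every pair of disjoint asymptotically separated nonempty sets is separated by an
  unbounded slowly oscillating function, while bounded ones are eventually constant, so the
  compactification has a single point at infinity and every permutation of \<open>X\<close> extends to it.
\<close>

definition M_normal ::
    "'m::metric_space itself \<Rightarrow> 'a set \<Rightarrow> ('a \<times> 'a) set set \<Rightarrow> bool" where
  "M_normal M X \<E> \<longleftrightarrow>
     (\<forall>A B. A \<subseteq> X \<and> B \<subseteq> X \<and> A \<noteq> {} \<and> B \<noteq> {} \<and> A \<inter> B = {} \<and>
            asymptotically_separated X \<E> A B \<longrightarrow>
        (\<exists>\<phi>\<in>so M X \<E>. Inf {dist (\<phi> a) (\<phi> b) | a b. a \<in> A \<and> b \<in> B} > 0))"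


subsection \<open>The compactification\<close>

definition M_embedding ::
    "'m::metric_space itself \<Rightarrow> 'a set \<Rightarrow> ('a \<times> 'a) set set \<Rightarrow> 'a \<Rightarrow> (('a \<Rightarrow> 'm) \<Rightarrow> 'm)" where
  "M_embedding M X \<E> x = (\<lambda>f\<in>so M X \<E>. f x)"

definition M_compactification ::
    "'m::metric_space itself \<Rightarrow> 'a set \<Rightarrow> ('a \<times> 'a) set set \<Rightarrow> (('a \<Rightarrow> 'm) \<Rightarrow> 'm) topology" where
  "M_compactification M X \<E> =
     (let P = product_topology (\<lambda>_. euclidean) (so M X \<E>)
      in subtopology P (P closure_of (M_embedding M X \<E> ` X)))"


subsection \<open>Permutation groups\<close>

definition isolated_points :: "'k topology \<Rightarrow> 'k set" where
  "isolated_points K = {x \<in> topspace K. openin K {x}}"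

definition homeos_fixing_nonisolated :: "'k topology \<Rightarrow> ('k \<Rightarrow> 'k) set" where
  "homeos_fixing_nonisolated K =
     {g. homeomorphic_map K K g \<and> (\<forall>x\<in>topspace K - isolated_points K. g x = x)}"

definition permutation_group :: "'k topology \<Rightarrow> ('k \<Rightarrow> 'k) set" where
  "permutation_group K = (\<lambda>g. restrict g (isolated_points K)) ` homeos_fixing_nonisolated K"

text \<open>
  The permutations of \<open>X\<close> that correspond to members of \<open>H\<close> when \<open>X\<close> is identified with its
  image under the injection \<open>\<delta>\<close>.
\<close>

definition pullback_permutations ::
    "'a set \<Rightarrow> ('a \<Rightarrow> 'k) \<Rightarrow> ('k \<Rightarrow> 'k) set \<Rightarrow> ('a \<Rightarrow> 'a) set" where
  "pullback_permutations X \<delta> H = {\<sigma> \<in> X \<rightarrow>\<^sub>E X. \<exists>g\<in>H. \<forall>x\<in>X. \<delta> (\<sigma> x) = g (\<delta> x)}"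

definition action_entourage :: "'a set \<Rightarrow> ('a \<Rightarrow> 'a) set \<Rightarrow> ('a \<times> 'a) set" where
  "action_entourage X F = {(x, y) \<in> X \<times> X. y \<in> {x} \<union> {g x | g. g \<in> F}}"

definition action_coarse_structure :: "'a set \<Rightarrow> ('a \<Rightarrow> 'a) set \<Rightarrow> ('a \<times> 'a) set set" where
  "action_coarse_structure X G =
     {E. entourage X E \<and> (\<exists>F. finite F \<and> F \<subseteq> G \<and> E \<subseteq> action_entourage X F)}"

end

theory Submission
  imports Defs
begin

text \<open>
  Everything rests on describing the permutation group \<open>G\<close> of the compactification \<open>K\<close> without
  mentioning \<open>K\<close>. A bijection \<open>\<sigma>\<close> of \<open>X\<close> belongs to \<open>G\<close> iff no bounded slowly oscillating function
  distinguishes \<open>\<sigma>\<close> from the identity at infinity: for every such \<open>f\<close> and every \<open>\<epsilon> > 0\<close> only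
  finitely many \<open>x \<in> X\<close> satisfy \<open>dist (f x) (f (\<sigma> x)) \<ge> \<epsilon>\<close>. If there were infinitely many such
  points for a \<open>\<sigma>\<close> in \<open>G\<close>, they would accumulate in the compact space \<open>K\<close> at a point outside \<open>X\<close>,
  which the homeomorphism extending \<open>\<sigma>\<close> fixes; continuity of the \<open>f\<close>-coordinate there is
  contradicted (\<open>permutation_group_displacement\<close>). Conversely, the condition says exactly that
  the extension of \<open>\<sigma>\<close> by the identity is continuous at the points of \<open>K\<close> outside \<open>X\<close>
  (\<open>in_permutation_groupI\<close>).

  For \<open>\<E> \<subseteq> \<E>\<^sub>G\<close>, a symmetric member \<open>E\<close> of a finitary structure is a graph of bounded degree on
  \<open>X\<close>, hence a finite union of graphs of involutions of \<open>X\<close>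
  (\<open>bounded_degree_covered_by_involutions\<close>). Each of these moves points along \<open>E\<close> only, so slow
  oscillation makes its effect on any \<open>f\<close> smaller than \<open>\<epsilon>\<close> off a bounded set, and bounded sets
  are finite; thus the involution lies in \<open>G\<close>.

  For \<open>\<E>\<^sub>G \<subseteq> \<E>\<close> it is enough that each \<open>\<sigma>\<close> in \<open>G\<close> has bounded displacement \<open>d x (\<sigma> x)\<close>. If the
  displacement is unbounded, one can thin out the pairs \<open>(x, \<sigma> x)\<close> to infinitely many whose first
  and second entries form disjoint asymptotically separated sets
  (\<open>unbounded_pairs_imp_separated_pairs\<close>). Normality gives a function that stays a positive
  distance apart on the two sets, hence distinguishes \<open>x\<close> from \<open>\<sigma> x\<close> at infinitely many points,
  which is impossible for a member of \<open>G\<close>.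
\<close>


section \<open>Relations of bounded degree as finite unions of involutions\<close>

text \<open>
  Every vertex outside a maximal independent set has a neighbour in it. Giving such a set a colour
  of its own therefore lowers the degree bound on the remaining vertices, and induction on the
  bound applies. Zorn's lemma provides the set when \<open>V\<close> is infinite.
\<close>
lemma bounded_degree_colouring:
  fixes R :: "('a \<times> 'a) set"
  assumes "sym R" and "irrefl R"
    and "\<And>x. x \<in> V \<Longrightarrow> finite (R `` {x} \<inter> V) \<and> card (R `` {x} \<inter> V) \<le> n"
  obtains c :: "'a \<Rightarrow> nat"
  where "c ` V \<subseteq> {..n}" and "\<And>x y. x \<in> V \<Longrightarrow> y \<in> V \<Longrightarrow> (x, y) \<in> R \<Longrightarrow> c x \<noteq> c y"
proof -
  have "\<exists>c. c ` V \<subseteq> {..n} \<and> (\<forall>x\<in>V. \<forall>y\<in>V. (x, y) \<in> R \<longrightarrow> c x \<noteq> c y)"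
    using assms(3)
  proof (induction n arbitrary: V)
    case 0
    then have "R `` {x} \<inter> V = {}" if "x \<in> V" for x
      using that by fastforce
    then have "(x, y) \<notin> R" if "x \<in> V" "y \<in> V" for x y
      using that by blast
    then show ?case
      by (intro exI[of _ "\<lambda>_. 0"]) auto
  next
    case (Suc n)
    define \<I> where "\<I> = {I. I \<subseteq> V \<and> (\<forall>x\<in>I. \<forall>y\<in>I. (x, y) \<notin> R)}"
    have "\<exists>I\<in>\<I>. \<forall>J\<in>\<I>. I \<subseteq> J \<longrightarrow> J = I"
    proof (rule subset_Zorn')
      fix C assume C: "subset.chain \<I> C"
      then have "C \<subseteq> \<I>" and chain: "\<And>I J. I \<in> C \<Longrightarrow> J \<in> C \<Longrightarrow> I \<subseteq> J \<or> J \<subseteq> I"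
        by (auto simp: subset_chain_def)
      then have "(x, y) \<notin> R" if "x \<in> I" "I \<in> C" "y \<in> J" "J \<in> C" for x y I J
        using chain[of I J] that unfolding \<I>_def by blast
      then have "\<forall>x\<in>\<Union>C. \<forall>y\<in>\<Union>C. (x, y) \<notin> R"
        by (meson UnionE)
      moreover have "\<Union>C \<subseteq> V"
        using \<open>C \<subseteq> \<I>\<close> unfolding \<I>_def by blast
      ultimately show "\<Union>C \<in> \<I>"
        unfolding \<I>_def by simp
    qed
    then obtain I where I: "I \<in> \<I>" and max: "\<And>J. J \<in> \<I> \<Longrightarrow> I \<subseteq> J \<Longrightarrow> J = I"
      by blast
    have neighbour: "\<exists>y\<in>I. (x, y) \<in> R" if "x \<in> V - I" for x
    proof (rule ccontr)
      assume "\<not> ?thesis"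
      then have "insert x I \<in> \<I>"
        using that I assms(1,2) unfolding \<I>_def by (auto simp: sym_def irrefl_def)
      with max[of "insert x I"] that show False
        by blast
    qed
    have "finite (R `` {x} \<inter> (V - I)) \<and> card (R `` {x} \<inter> (V - I)) \<le> n" if x: "x \<in> V - I" for x
    proof -
      have "R `` {x} \<inter> (V - I) \<subset> R `` {x} \<inter> V"
        using neighbour[OF x] I unfolding \<I>_def by blast
      moreover have "finite (R `` {x} \<inter> V)" "card (R `` {x} \<inter> V) \<le> Suc n"
        using Suc.prems[of x] x by auto
      ultimately show ?thesis
        using psubset_card_mono[of "R `` {x} \<inter> V" "R `` {x} \<inter> (V - I)"]
        by (meson finite_subset less_Suc_eq_le order_less_le_trans psubset_imp_subset)
    qed
    from Suc.IH[OF this] obtain c where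
      c: "c ` (V - I) \<subseteq> {..n}" "\<And>x y. x \<in> V - I \<Longrightarrow> y \<in> V - I \<Longrightarrow> (x, y) \<in> R \<Longrightarrow> c x \<noteq> c y"
      by blast
    have le: "c x \<le> n" if "x \<in> V" "x \<notin> I" for x
      using c(1) that by auto
    define c' where "c' x = (if x \<in> I then Suc n else c x)" for x
    have "c' ` V \<subseteq> {..Suc n}"
      using le unfolding c'_def by fastforce
    moreover have "c' x \<noteq> c' y" if "x \<in> V" "y \<in> V" "(x, y) \<in> R" for x y
      using that c(2)[of x y] le[of x] le[of y] I unfolding c'_def \<I>_def by auto
    ultimately show ?case
      by blast
  qed
  then show ?thesis
    using that by blast
qed

text \<open>
  Points at distance at most two in the graph \<open>E\<close> are coloured differently, so all points of a
  ball \<open>E `` {x}\<close> have distinct colours. The edges joining two prescribed colours are then pairwise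
  disjoint, and exchanging the ends of each of them is an involution. The bound is
  on \<open>E O E\<close> because this is the relation that is coloured.
\<close>
lemma bounded_degree_covered_by_involutions:
  fixes E :: "('a \<times> 'a) set"
  assumes "Id_on X \<subseteq> E" and "E \<subseteq> X \<times> X" and "sym E"
    and deg: "\<And>x. x \<in> X \<Longrightarrow> finite ((E O E) `` {x}) \<and> card ((E O E) `` {x}) \<le> n"
  obtains F where "finite F" and "F \<subseteq> X \<rightarrow>\<^sub>E X"
    and "\<And>\<sigma> x. \<sigma> \<in> F \<Longrightarrow> x \<in> X \<Longrightarrow> \<sigma> (\<sigma> x) = x \<and> (x, \<sigma> x) \<in> E"
    and "\<And>x y. (x, y) \<in> E \<Longrightarrow> \<exists>\<sigma>\<in>F. \<sigma> x = y"
proof -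
  let ?R = "E O E - Id"
  have "sym ?R"
    using \<open>sym E\<close> unfolding sym_def by blast
  moreover have "irrefl ?R"
    by (auto simp: irrefl_def)
  moreover have "finite (?R `` {x} \<inter> X) \<and> card (?R `` {x} \<inter> X) \<le> n" if "x \<in> X" for x
  proof -
    have "?R `` {x} \<inter> X \<subseteq> (E O E) `` {x}"
      by blast
    with deg[OF that] show ?thesis
      by (meson card_mono finite_subset le_trans)
  qed
  ultimately obtain c :: "'a \<Rightarrow> nat" where
    c_le: "c ` X \<subseteq> {..n}" and c_ne: "\<And>x y. x \<in> X \<Longrightarrow> y \<in> X \<Longrightarrow> (x, y) \<in> ?R \<Longrightarrow> c x \<noteq> c y"
    by (rule bounded_degree_colouring[of ?R X n]) auto
  have inj: "y = z" if "(x, y) \<in> E" "(x, z) \<in> E" "c y = c z" for x y z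
  proof (rule ccontr)
    assume "y \<noteq> z"
    moreover have "(y, x) \<in> E"
      using that(1) \<open>sym E\<close> by (simp add: symD)
    ultimately have "(y, z) \<in> ?R"
      using that(2) by blast
    moreover have "y \<in> X" "z \<in> X"
      using that(1,2) assms(2) by auto
    ultimately show False
      using c_ne that(3) by simp
  qed
  \<comment> \<open>Comparing unordered pairs of colours makes \<open>P i j\<close> symmetric in \<open>x\<close> and \<open>y\<close>; for \<open>i = j\<close> it only
    relates points to themselves, which takes care of the diagonal of \<open>E\<close>.\<close>
  define P where "P i j x y \<longleftrightarrow> (x, y) \<in> E \<and> {c x, c y} = {i, j}" for i j x y
  have P_sym: "P i j x y \<Longrightarrow> P i j y x" for i j x y
    using \<open>sym E\<close> unfolding P_def sym_def by (metis insert_commute)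
  have P_unique: "P i j x y \<Longrightarrow> P i j x z \<Longrightarrow> y = z" for i j x y z
    using inj[of x y z] unfolding P_def by (metis doubleton_eq_iff)
  define \<sigma> where "\<sigma> i j = (\<lambda>x\<in>X. if \<exists>y. P i j x y then THE y. P i j x y else x)" for i j
  have \<sigma>_P: "\<sigma> i j x = y" if "P i j x y" for i j x y
  proof -
    have "x \<in> X"
      using that assms(2) unfolding P_def by blast
    moreover have "(THE y. P i j x y) = y"
      using that P_unique by blast
    ultimately show ?thesis
      using that unfolding \<sigma>_def by auto
  qed
  have \<sigma>: "\<sigma> i j (\<sigma> i j x) = x \<and> (x, \<sigma> i j x) \<in> E" if "x \<in> X" for i j x
  proof (cases "\<exists>y. P i j x y")
    case True
    then obtain y where "P i j x y" ..
    then show ?thesis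
      using \<sigma>_P P_sym unfolding P_def by metis
  next
    case False
    then have "\<sigma> i j x = x"
      using that unfolding \<sigma>_def by auto
    then show ?thesis
      using that assms(1) by auto
  qed
  define F where "F = (\<lambda>(i, j). \<sigma> i j) ` ({..n} \<times> {..n})"
  show thesis
  proof
    show "finite F"
      unfolding F_def by blast
    show "F \<subseteq> X \<rightarrow>\<^sub>E X"
    proof
      fix \<tau> assume "\<tau> \<in> F"
      then obtain i j where "\<tau> = \<sigma> i j"
        unfolding F_def by auto
      moreover have "\<sigma> i j x \<in> X" if "x \<in> X" for x
        using \<sigma>[OF that, of i j] assms(2) by blast
      ultimately show "\<tau> \<in> X \<rightarrow>\<^sub>E X"
        by (simp add: \<sigma>_def PiE_iff)
    qed
    show "\<tau> (\<tau> x) = x \<and> (x, \<tau> x) \<in> E" if "\<tau> \<in> F" "x \<in> X" for \<tau> x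
      using that \<sigma> unfolding F_def by auto
    show "\<exists>\<tau>\<in>F. \<tau> x = y" if "(x, y) \<in> E" for x y
    proof (rule bexI[of _ "\<sigma> (c x) (c y)"])
      show "\<sigma> (c x) (c y) x = y"
        using \<sigma>_P that unfolding P_def by blast
      have "c x \<le> n" "c y \<le> n"
        using that assms(2) c_le by auto
      then show "\<sigma> (c x) (c y) \<in> F"
        unfolding F_def by auto
    qed
  qed
qed


section \<open>Coarse spaces\<close>

lemma coarse_space_entourage: "coarse_space X \<E> \<Longrightarrow> E \<in> \<E> \<Longrightarrow> entourage X E"
  by (simp add: coarse_space_def)

lemma coarse_space_subset:
  "coarse_space X \<E> \<Longrightarrow> F \<in> \<E> \<Longrightarrow> Id_on X \<subseteq> E \<Longrightarrow> E \<subseteq> F \<Longrightarrow> E \<in> \<E>"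
  unfolding coarse_space_def by metis

lemma coarse_space_converse_comp:
  assumes "coarse_space X \<E>" and "E \<in> \<E>" and "F \<in> \<E>"
  shows "E O F\<inverse> \<in> \<E>"
proof -
  have "\<forall>E\<in>\<E>. \<forall>F\<in>\<E>. \<exists>G\<in>\<E>. E O F\<inverse> \<subseteq> G"
    using assms(1) by (simp add: coarse_space_def)
  then obtain G where "G \<in> \<E>" "E O F\<inverse> \<subseteq> G"
    using assms(2,3) by blast
  moreover have "Id_on X \<subseteq> E" "Id_on X \<subseteq> F"
    using coarse_space_entourage[OF assms(1)] assms(2,3) by (simp_all add: entourage_def)
  then have "Id_on X \<subseteq> E O F\<inverse>"
    by blast
  ultimately show ?thesis
    using coarse_space_subset[OF assms(1)] by blast
qed

lemma coarse_space_converse: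
  assumes "coarse_space X \<E>" and "E \<in> \<E>"
  shows "E\<inverse> \<in> \<E>"
proof -
  have E: "Id_on X \<subseteq> E" "E \<subseteq> X \<times> X"
    using coarse_space_entourage[OF assms] by (auto simp: entourage_def)
  have "Id_on X \<in> \<E>"
    using coarse_space_subset[OF assms] E(1) by blast
  moreover have "Id_on X O E\<inverse> = E\<inverse>"
    using E by blast
  ultimately show ?thesis
    using coarse_space_converse_comp[OF assms(1) _ assms(2), of "Id_on X"] by simp
qed

lemma coarse_space_comp:
  assumes "coarse_space X \<E>" and "E \<in> \<E>" and "F \<in> \<E>"
  shows "E O F \<in> \<E>"
  using coarse_space_converse_comp[OF assms(1,2) coarse_space_converse[OF assms(1,3)]] by simp

text \<open>
  An entourage \<open>E\<close> can see the jump at \<open>x\<close> only from the points of \<open>E\<inverse> `` {x}\<close>, a bounded set. These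
  functions are what makes the points of \<open>X\<close> distinct and isolated in the compactification.
\<close>
lemma slowly_oscillating_point_indicator:
  assumes "coarse_space X \<E>" and "x \<in> X"
  shows "(\<lambda>y\<in>X. if y = x then b else a) \<in> so M X \<E>"
proof -
  let ?\<phi> = "\<lambda>y\<in>X. if y = x then b else a"
  have "bounded (?\<phi> ` X)"
    by (rule bounded_subset[of "{a, b}"]) auto
  moreover have "slowly_oscillating X \<E> ?\<phi>"
    unfolding slowly_oscillating_def
  proof (intro allI impI ballI)
    fix \<epsilon> :: real and E assume "\<epsilon> > 0" and E: "E \<in> \<E>"
    have ent: "Id_on X \<subseteq> E" "E \<subseteq> X \<times> X"
      using coarse_space_entourage[OF assms(1) E] by (auto simp: entourage_def)
    have "coarse_bounded X \<E> (E\<inverse> `` {x})"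
      unfolding coarse_bounded_def
      using ent(2) by (intro conjI bexI[OF _ assms(2)] bexI[OF _ coarse_space_converse[OF assms(1) E]]) auto
    moreover have "?\<phi> ` (E `` {y}) = {a}" if "y \<in> X - E\<inverse> `` {x}" for y
    proof -
      have "?\<phi> z = a" if "z \<in> E `` {y}" for z
        using that \<open>y \<in> X - E\<inverse> `` {x}\<close> ent by auto
      moreover have "y \<in> E `` {y}"
        using that ent by auto
      ultimately show ?thesis
        by (intro equalityI subsetI) (auto intro!: image_eqI[of a _ y] simp del: restrict_apply)
    qed
    ultimately show "\<exists>B. coarse_bounded X \<E> B \<and>
        (\<forall>y\<in>X - B. bounded (?\<phi> ` (E `` {y})) \<and> diameter (?\<phi> ` (E `` {y})) < \<epsilon>)"
      using \<open>\<epsilon> > 0\<close> by (intro exI[of _ "E\<inverse> `` {x}"]) simp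
  qed
  ultimately show ?thesis
    unfolding so_def by auto
qed

lemma finitary_slowly_oscillating_displacement:
  assumes "finitary X \<E>" and "E \<in> \<E>" and "entourage X E" and "f \<in> so M X \<E>"
    and graph: "\<And>x. x \<in> X \<Longrightarrow> (x, \<sigma> x) \<in> E" and "\<epsilon> > 0"
  shows "finite {x \<in> X. \<epsilon> \<le> dist (f x) (f (\<sigma> x))}"
proof -
  obtain B where B: "coarse_bounded X \<E> B"
    and small: "\<And>x. x \<in> X - B \<Longrightarrow> bounded (f ` (E `` {x})) \<and> diameter (f ` (E `` {x})) < \<epsilon>"
    using assms(2,4) \<open>\<epsilon> > 0\<close> unfolding so_def slowly_oscillating_def mem_Collect_eq by meson
  have "finite B"
    using B assms(1) unfolding coarse_bounded_def finitary_def by (meson finite_subset)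
  moreover have "dist (f x) (f (\<sigma> x)) < \<epsilon>" if "x \<in> X - B" for x
  proof -
    have "x \<in> E `` {x}" "\<sigma> x \<in> E `` {x}"
      using that assms(3) graph unfolding entourage_def by auto
    then show ?thesis
      using small[OF that] diameter_bounded_bound[of "f ` (E `` {x})" "f x" "f (\<sigma> x)"] by fastforce
  qed
  ultimately show ?thesis
    by (elim finite_subset[rotated]) force
qed


section \<open>The compactification and its permutation group\<close>

locale coarse_compactification =
  fixes M :: "'m::metric_space itself" and X :: "'a set" and \<E> :: "('a \<times> 'a) set set"
  assumes proper: "proper_metric_space M" and coarse: "coarse_space X \<E>"
begin

abbreviation "\<delta> \<equiv> M_embedding M X \<E>"
abbreviation "K \<equiv> M_compactification M X \<E>"
abbreviation "P \<equiv> product_topology (\<lambda>_. euclidean :: 'm topology) (so M X \<E>)"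

lemma K_eq: "K = subtopology P (P closure_of (\<delta> ` X))"
  unfolding M_compactification_def Let_def ..

lemma embedding_apply: "f \<in> so M X \<E> \<Longrightarrow> \<delta> x f = f x"
  unfolding M_embedding_def by simp

lemma topspace_K: "topspace K = P closure_of (\<delta> ` X)"
  unfolding K_eq topspace_subtopology using closure_of_subset_topspace by fast

lemma embedding_in_K: "x \<in> X \<Longrightarrow> \<delta> x \<in> topspace K"
  unfolding topspace_K
  by (rule subsetD[OF closure_of_subset]) (auto simp: M_embedding_def)

lemma K_extensional: "p \<in> topspace K \<Longrightarrow> p \<in> extensional (so M X \<E>)"
  unfolding K_eq by (simp add: PiE_def)

text \<open>
  The image of \<open>X\<close> lies in the product of the closures of the bounded sets \<open>f ` X\<close>, which are
  compact because \<open>M\<close> is proper.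
\<close>
lemma compact_K: "compact_space K"
proof -
  let ?C = "PiE (so M X \<E>) (\<lambda>f. closure (f ` X))"
  have "compact (closure (f ` X))" if "f \<in> so M X \<E>" for f :: "'a \<Rightarrow> 'm"
    using that proper unfolding proper_metric_space_def so_def by (simp add: bounded_closure)
  then have "compactin P ?C"
    by (simp add: compactin_PiE)
  moreover have "\<delta> ` X \<subseteq> ?C"
    using closure_subset by (fastforce simp: M_embedding_def)
  moreover have "closedin P ?C"
    by (simp add: closedin_product_topology)
  ultimately have "compactin P (P closure_of (\<delta> ` X))"
    by (rule closed_compactin[OF _ closure_of_minimal closedin_closure_of])
  then show ?thesis
    unfolding K_eq by (rule compact_space_subtopology)
qed

lemma Hausdorff_K: "Hausdorff_space K"
  unfolding K_eq
  by (simp add: Hausdorff_space_subtopology Hausdorff_space_product_topology)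

lemma continuous_coordinate:
  assumes "f \<in> so M X \<E>"
  shows "continuous_map K euclidean (\<lambda>p. p f)"
  unfolding K_eq
  by (intro continuous_map_from_subtopology continuous_map_product_projection assms)

lemma embedding_dense:
  assumes "openin K U" and "p \<in> U"
  obtains x where "x \<in> X" and "\<delta> x \<in> U"
proof -
  obtain T where T: "openin P T" "U = T \<inter> P closure_of (\<delta> ` X)"
    using assms(1) unfolding K_eq openin_subtopology by blast
  then obtain x where "x \<in> X" "\<delta> x \<in> T"
    using assms(2) by (auto simp: in_closure_of)
  then show thesis
    using that T embedding_in_K unfolding topspace_K by blast
qed

lemma point_indicator:
  assumes "x \<in> X"
  obtains f :: "'a \<Rightarrow> 'm" and a where "f \<in> so M X \<E>" and "f x \<noteq> a"
    and "\<And>y. y \<in> X \<Longrightarrow> y \<noteq> x \<Longrightarrow> f y = a"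
proof -
  obtain a b :: 'm where "b \<noteq> a"
    using proper unfolding proper_metric_space_def by metis
  then show thesis
    using slowly_oscillating_point_indicator[OF coarse assms, of b a M] assms
    by (intro that[of "\<lambda>y\<in>X. if y = x then b else a" a]) auto
qed

lemma inj_embedding: "inj_on \<delta> X"
proof (rule inj_onI, rule ccontr)
  fix x y assume xy: "x \<in> X" "y \<in> X" "\<delta> x = \<delta> y" "x \<noteq> y"
  obtain f and a :: 'm where "f \<in> so M X \<E>" "f x \<noteq> a" "\<And>y. y \<in> X \<Longrightarrow> y \<noteq> x \<Longrightarrow> f y = a"
    using point_indicator[OF xy(1)] by blast
  then show False
    using xy embedding_apply by metis
qed

text \<open>
  The indicator of \<open>x\<close> cuts out an open set \<open>U\<close> of \<open>K\<close> that contains no other point of \<open>X\<close>. By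
  density of \<open>X\<close>, the open set \<open>U - {\<delta> x}\<close> is empty.
\<close>
lemma openin_embedding_point:
  assumes "x \<in> X"
  shows "openin K {\<delta> x}"
proof -
  obtain f and a :: 'm where f: "f \<in> so M X \<E>" "f x \<noteq> a" "\<And>y. y \<in> X \<Longrightarrow> y \<noteq> x \<Longrightarrow> f y = a"
    using point_indicator[OF assms] by blast
  define U where "U = {p \<in> topspace K. p f \<in> - {a}}"
  have U: "openin K U"
    unfolding U_def by (rule openin_continuous_map_preimage[OF continuous_coordinate]) (auto simp: f)
  have "p = \<delta> x" if "p \<in> U" for p
  proof (rule ccontr)
    assume "p \<noteq> \<delta> x"
    have "closedin K {\<delta> x}"
      using Hausdorff_K embedding_in_K[OF assms] by (simp add: closedin_Hausdorff_singleton)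
    then have "openin K (U - {\<delta> x})"
      using U by blast
    moreover have "p \<in> U - {\<delta> x}"
      using \<open>p \<noteq> \<delta> x\<close> that by blast
    ultimately obtain y where "y \<in> X" "\<delta> y \<in> U - {\<delta> x}"
      by (rule embedding_dense) (rule that)
    then show False
      using f embedding_apply unfolding U_def by auto
  qed
  moreover have "\<delta> x \<in> U"
    using f embedding_apply embedding_in_K[OF assms] unfolding U_def by auto
  ultimately have "U = {\<delta> x}"
    by blast
  then show ?thesis
    using U by simp
qed

lemma isolated_points_K: "isolated_points K = \<delta> ` X"
proof
  show "isolated_points K \<subseteq> \<delta> ` X"
    unfolding isolated_points_def using embedding_dense by blast
  show "\<delta> ` X \<subseteq> isolated_points K"
    unfolding isolated_points_def using openin_embedding_point embedding_in_K by blast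
qed

text \<open>
  An accumulation point \<open>p\<close> of infinitely many points displaced by \<open>\<epsilon>\<close> is not isolated, so the
  homeomorphism \<open>g\<close> inducing \<open>\<sigma>\<close> fixes it. Near \<open>p\<close> the \<open>f\<close>-coordinates of \<open>q\<close> and of \<open>g q\<close> are both
  close to that of \<open>p\<close>, so displaced points cannot come near.
\<close>
lemma permutation_group_displacement:
  assumes "\<sigma> \<in> pullback_permutations X \<delta> (permutation_group K)"
    and f: "f \<in> so M X \<E>" and "\<epsilon> > 0"
  shows "finite {x \<in> X. \<epsilon> \<le> dist (f x) (f (\<sigma> x))}" (is "finite ?D")
proof (rule ccontr)
  assume "infinite ?D"
  obtain g where hom: "homeomorphic_map K K g"
    and fixed: "\<And>p. p \<in> topspace K \<Longrightarrow> p \<notin> \<delta> ` X \<Longrightarrow> g p = p"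
    and g: "\<And>x. x \<in> X \<Longrightarrow> \<delta> (\<sigma> x) = g (\<delta> x)"
    using assms(1)
    unfolding pullback_permutations_def permutation_group_def homeos_fixing_nonisolated_def
      isolated_points_K
    by auto
  have "infinite (\<delta> ` ?D)"
    using \<open>infinite ?D\<close> inj_embedding by (subst finite_image_iff) (auto intro: inj_on_subset)
  moreover have "\<delta> ` ?D \<subseteq> topspace K"
    using embedding_in_K by blast
  ultimately have "K derived_set_of (\<delta> ` ?D) \<noteq> {}"
    using compact_space_imp_Bolzano_Weierstrass[OF compact_K] by blast
  then obtain p where "p \<in> K derived_set_of (\<delta> ` ?D)"
    by blast
  then have p: "p \<in> topspace K"
    and acc: "\<And>T. p \<in> T \<Longrightarrow> openin K T \<Longrightarrow> \<exists>q\<in>\<delta> ` ?D. q \<noteq> p \<and> q \<in> T"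
    unfolding in_derived_set_of by blast+
  have "p \<notin> \<delta> ` X"
    using acc[of "{p}"] openin_embedding_point by blast
  then have gp: "g p = p"
    using fixed p by blast
  define V where "V = {q \<in> topspace K. q f \<in> ball (p f) (\<epsilon> / 2)} \<inter>
                      {q \<in> topspace K. g q f \<in> ball (p f) (\<epsilon> / 2)}"
  have "continuous_map K euclidean (\<lambda>q. g q f)"
    using continuous_map_compose[OF homeomorphic_imp_continuous_map[OF hom] continuous_coordinate[OF f]]
    by (simp add: o_def)
  then have "openin K V"
    unfolding V_def
    by (intro openin_Int openin_continuous_map_preimage[of K euclidean] continuous_coordinate f) auto
  moreover have "p \<in> V"
    using p gp \<open>\<epsilon> > 0\<close> unfolding V_def by auto
  ultimately obtain x where x: "x \<in> ?D" "\<delta> x \<in> V"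
    using acc[of V] by blast
  then have "dist (p f) (f x) < \<epsilon> / 2" "dist (p f) (f (\<sigma> x)) < \<epsilon> / 2"
    using g[of x] f embedding_apply unfolding V_def by (auto, metis)
  then have "dist (f x) (f (\<sigma> x)) < \<epsilon>"
    by (metis dist_commute dist_triangle_half_l)
  with x show False
    by auto
qed

text \<open>
  The extension \<open>g\<close> of \<open>\<sigma>\<close> by the identity is a bijection of the compact Hausdorff space \<open>K\<close>, so
  only its continuity is at stake, and this may be tested on one \<open>f\<close>-coordinate at a time. At
  isolated points nothing has to be shown. At any other point \<open>p\<close>, where \<open>g p = p\<close>, discarding the
  finitely many points displaced by at least \<open>\<epsilon> / 2\<close> from a neighbourhood of \<open>p\<close> leaves one on
  which the coordinate of \<open>g q\<close> is within \<open>\<epsilon>\<close> of that of \<open>p\<close>.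
\<close>
lemma in_permutation_groupI:
  assumes "\<sigma> \<in> extensional X" and bij: "bij_betw \<sigma> X X"
    and finite: "\<And>f \<epsilon>. f \<in> so M X \<E> \<Longrightarrow> \<epsilon> > 0 \<Longrightarrow> finite {x \<in> X. \<epsilon> \<le> dist (f x) (f (\<sigma> x))}"
  shows "\<sigma> \<in> pullback_permutations X \<delta> (permutation_group K)"
proof -
  define g where "g p = (if p \<in> \<delta> ` X then \<delta> (\<sigma> (inv_into X \<delta> p)) else p)" for p
  have g: "g (\<delta> x) = \<delta> (\<sigma> x)" if "x \<in> X" for x
    using that inj_embedding unfolding g_def by simp
  have fixed: "g p = p" if "p \<notin> \<delta> ` X" for p
    using that unfolding g_def by simp
  have \<sigma>X: "\<sigma> ` X = X" "\<And>x. x \<in> X \<Longrightarrow> \<sigma> x \<in> X"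
    using bij by (auto simp: bij_betw_def)
  have "bij_betw g (\<delta> ` X) (\<delta> ` X)"
    unfolding bij_betw_def
  proof
    show "inj_on g (\<delta> ` X)"
    proof (rule inj_onI)
      fix p q assume "p \<in> \<delta> ` X" "q \<in> \<delta> ` X" and "g p = g q"
      then obtain x y where xy: "x \<in> X" "y \<in> X" "p = \<delta> x" "q = \<delta> y"
        by blast
      with \<open>g p = g q\<close> have "\<delta> (\<sigma> x) = \<delta> (\<sigma> y)"
        by (simp add: g)
      then have "\<sigma> x = \<sigma> y"
        using inj_onD[OF inj_embedding] \<sigma>X(2) xy by blast
      then show "p = q"
        using inj_onD[OF bij_betw_imp_inj_on[OF bij]] xy by blast
    qed
    have "g ` \<delta> ` X = \<delta> ` \<sigma> ` X"
      unfolding image_image using g by simp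
    then show "g ` \<delta> ` X = \<delta> ` X"
      using \<sigma>X by simp
  qed
  moreover have "bij_betw g (topspace K - \<delta> ` X) (topspace K - \<delta> ` X)"
    using fixed by (auto simp: bij_betw_def inj_on_def)
  ultimately have "bij_betw g (\<delta> ` X \<union> (topspace K - \<delta> ` X)) (\<delta> ` X \<union> (topspace K - \<delta> ` X))"
    by (rule bij_betw_combine) blast
  moreover have "\<delta> ` X \<union> (topspace K - \<delta> ` X) = topspace K"
    using embedding_in_K by blast
  ultimately have bij_g: "bij_betw g (topspace K) (topspace K)"
    by simp
  then have g_K: "g p \<in> topspace K" if "p \<in> topspace K" for p
    using that by (auto simp: bij_betw_def)
  have "continuous_map K euclidean (\<lambda>p. g p f)" if f: "f \<in> so M X \<E>" for f
    unfolding continuous_map_def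
  proof (intro conjI allI impI)
    fix W :: "'m set" assume "openin euclidean W"
    show "openin K {p \<in> topspace K. g p f \<in> W}"
    proof (subst openin_subopen, intro ballI)
      fix p assume "p \<in> {p \<in> topspace K. g p f \<in> W}"
      then have p: "p \<in> topspace K" "g p f \<in> W"
        by auto
      show "\<exists>T. openin K T \<and> p \<in> T \<and> T \<subseteq> {p \<in> topspace K. g p f \<in> W}"
      proof (cases "p \<in> \<delta> ` X")
        case True
        then show ?thesis
          using p openin_embedding_point by blast
      next
        case False
        then have "p f \<in> W"
          using p fixed by simp
        then obtain \<epsilon> where \<epsilon>: "\<epsilon> > 0" "ball (p f) \<epsilon> \<subseteq> W"
          using \<open>openin euclidean W\<close> by (auto simp: open_contains_ball)
        define D where "D = {x \<in> X. \<epsilon> / 2 \<le> dist (f x) (f (\<sigma> x))}"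
        define N where "N = {q \<in> topspace K. q f \<in> ball (p f) (\<epsilon> / 2)} - \<delta> ` D"
        have D: "D \<subseteq> X" "finite D"
          using finite[OF f, of "\<epsilon> / 2"] \<epsilon> unfolding D_def by auto
        then have "closedin K (\<delta> ` D)"
          using Hausdorff_K embedding_in_K by (intro closedin_Hausdorff_finite) auto
        then have "openin K N"
          unfolding N_def
          by (intro openin_diff openin_continuous_map_preimage[of K euclidean]
              continuous_coordinate f) auto
        moreover have "p \<in> N"
          using p False D \<epsilon> unfolding N_def by auto
        moreover have "g q f \<in> W" if "q \<in> N" for q
        proof (cases "q \<in> \<delta> ` X")
          case True
          then obtain x where x: "x \<in> X" "q = \<delta> x"
            by blast
          then have "dist (p f) (f x) < \<epsilon> / 2"
            using that f embedding_apply unfolding N_def by auto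
          moreover have "dist (f x) (f (\<sigma> x)) < \<epsilon> / 2"
            using that x unfolding N_def D_def by force
          ultimately have "dist (p f) (f (\<sigma> x)) < \<epsilon>"
            using dist_triangle[of "p f" "f (\<sigma> x)" "f x"] by linarith
          then show ?thesis
            using x g f embedding_apply \<epsilon> by auto
        next
          case False
          then show ?thesis
            using that fixed \<epsilon> unfolding N_def by auto
        qed
        ultimately show ?thesis
          unfolding N_def by (intro exI[of _ N]) (auto simp: N_def)
      qed
    qed
  qed auto
  moreover have "g ` topspace K \<subseteq> extensional (so M X \<E>)"
    using g_K K_extensional by blast
  ultimately have "continuous_map K P g"
    by (simp add: continuous_map_componentwise)
  then have "continuous_map K K g"
    using g_K by (subst (2) K_eq) (auto simp: continuous_map_in_subtopology topspace_K)
  then have "homeomorphic_map K K g"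
    using bij_g compact_K Hausdorff_K
    by (intro continuous_imp_homeomorphic_map) (auto simp: bij_betw_def)
  then have "g \<in> homeos_fixing_nonisolated K"
    using fixed unfolding homeos_fixing_nonisolated_def isolated_points_K by blast
  then have "restrict g (\<delta> ` X) \<in> permutation_group K"
    unfolding permutation_group_def isolated_points_K by blast
  moreover have "\<sigma> \<in> X \<rightarrow>\<^sub>E X"
    using assms(1) \<sigma>X by (auto simp: PiE_def)
  ultimately show ?thesis
    unfolding pullback_permutations_def using g by (auto intro!: bexI[of _ "restrict g (\<delta> ` X)"])
qed

lemma finitary_imp_subset_action:
  assumes "finitary X \<E>"
  shows "\<E> \<subseteq> action_coarse_structure X (pullback_permutations X \<delta> (permutation_group K))"
proof
  fix E assume E: "E \<in> \<E>"
  then have ent: "entourage X E"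
    using coarse coarse_space_entourage by blast
  \<comment> \<open>A symmetric entourage of the structure that contains \<open>E\<close>.\<close>
  define E' where "E' = E O E\<inverse>"
  have E': "E' \<in> \<E>"
    unfolding E'_def by (rule coarse_space_converse_comp[OF coarse E E])
  then have ent': "entourage X E'"
    using coarse coarse_space_entourage by blast
  have "E \<subseteq> E'"
    using ent unfolding E'_def entourage_def by fastforce
  have "sym E'"
    unfolding E'_def sym_def by blast
  obtain n where "\<And>x. x \<in> X \<Longrightarrow> finite ((E' O E') `` {x}) \<and> card ((E' O E') `` {x}) \<le> n"
    using assms coarse_space_comp[OF coarse E' E'] unfolding finitary_def by blast
  moreover have "Id_on X \<subseteq> E'" "E' \<subseteq> X \<times> X"
    using ent' by (simp_all add: entourage_def)
  ultimately obtain F where F: "finite F" "F \<subseteq> X \<rightarrow>\<^sub>E X"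
    and inv: "\<And>\<sigma> x. \<sigma> \<in> F \<Longrightarrow> x \<in> X \<Longrightarrow> \<sigma> (\<sigma> x) = x \<and> (x, \<sigma> x) \<in> E'"
    and cover: "\<And>x y. (x, y) \<in> E' \<Longrightarrow> \<exists>\<sigma>\<in>F. \<sigma> x = y"
    using bounded_degree_covered_by_involutions[OF _ _ \<open>sym E'\<close>, of X n thesis] by simp
  have "F \<subseteq> pullback_permutations X \<delta> (permutation_group K)"
  proof
    fix \<sigma> assume \<sigma>: "\<sigma> \<in> F"
    then have "\<sigma> \<in> X \<rightarrow>\<^sub>E X"
      using F by blast
    then have "\<sigma> \<in> extensional X" "\<sigma> \<in> X \<rightarrow> X"
      by (auto simp: PiE_def)
    moreover have "bij_betw \<sigma> X X"
      by (rule bij_betwI[of \<sigma> X X \<sigma>]) (use \<open>\<sigma> \<in> X \<rightarrow> X\<close> inv[OF \<sigma>] in auto)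
    moreover have "finite {x \<in> X. \<epsilon> \<le> dist (f x) (f (\<sigma> x))}"
      if "f \<in> so M X \<E>" "\<epsilon> > 0" for f \<epsilon>
      by (rule finitary_slowly_oscillating_displacement[OF assms E' ent' that(1) _ that(2)])
        (use inv[OF \<sigma>] in blast)
    ultimately show "\<sigma> \<in> pullback_permutations X \<delta> (permutation_group K)"
      by (intro in_permutation_groupI)
  qed
  moreover have "E \<subseteq> action_entourage X F"
  proof (rule subrelI)
    fix x y assume xy: "(x, y) \<in> E"
    then obtain \<sigma> where "\<sigma> \<in> F" "\<sigma> x = y"
      using cover \<open>E \<subseteq> E'\<close> by blast
    then show "(x, y) \<in> action_entourage X F"
      using xy ent unfolding action_entourage_def entourage_def by blast
  qed
  ultimately show "E \<in> action_coarse_structure X (pullback_permutations X \<delta> (permutation_group K))"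
    unfolding action_coarse_structure_def using ent F(1) by blast
qed

end


section \<open>Metrizable coarse structures\<close>

locale metric_coarse_structure = Metric_space X d
  for X :: "'a set" and d :: "'a \<Rightarrow> 'a \<Rightarrow> real" +
  fixes \<E> :: "('a \<times> 'a) set set"
  assumes \<E>_eq: "\<E> = {E. entourage X E \<and> (\<exists>n::nat. E \<subseteq> {(x, y). d x y \<le> real n})}"
begin

lemma entourage_bound:
  assumes "E \<in> \<E>"
  obtains r where "\<And>x y. (x, y) \<in> E \<Longrightarrow> x \<in> X \<and> y \<in> X \<and> d x y \<le> r"
  using assms unfolding \<E>_eq entourage_def by fast

lemma coarse_boundedI:
  assumes "o' \<in> X" and "B \<subseteq> X" and "\<And>x. x \<in> B \<Longrightarrow> d o' x \<le> r"
  shows "coarse_bounded X \<E> B"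
proof -
  obtain n where n: "r \<le> real n"
    using real_arch_simple by blast
  let ?E = "{(x, y) \<in> X \<times> X. d x y \<le> real n}"
  have "?E \<in> \<E>"
    unfolding \<E>_eq entourage_def by auto
  moreover have "B \<subseteq> ?E `` {o'}"
    using assms n by fastforce
  ultimately show ?thesis
    unfolding coarse_bounded_def using assms by blast
qed

text \<open>
  Here \<open>A\<close> is bounded, and then so is already \<open>E `` A\<close> for every \<open>E\<close> in the structure.
\<close>
lemma asymptotically_separated_bounded:
  assumes "o' \<in> X" and "A \<subseteq> X" and "\<And>x. x \<in> A \<Longrightarrow> d o' x \<le> r"
  shows "asymptotically_separated X \<E> A B"
  unfolding asymptotically_separated_def
proof
  fix E assume "E \<in> \<E>"
  then obtain s where s: "\<And>x y. (x, y) \<in> E \<Longrightarrow> x \<in> X \<and> y \<in> X \<and> d x y \<le> s"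
    by (rule entourage_bound) blast
  show "coarse_bounded X \<E> (E `` A \<inter> E `` B)"
  proof (rule coarse_boundedI[OF assms(1)])
    show "E `` A \<inter> E `` B \<subseteq> X"
      using s by blast
    fix z assume "z \<in> E `` A \<inter> E `` B"
    then obtain x where "x \<in> A" "(x, z) \<in> E"
      by blast
    then show "d o' z \<le> r + s"
      using s[of x z] assms triangle[of o' x z] by fastforce
  qed
qed

lemma asymptotically_separated_sym:
  "asymptotically_separated X \<E> A B \<longleftrightarrow> asymptotically_separated X \<E> B A"
  unfolding asymptotically_separated_def by (simp add: Int_commute)

text \<open>
  Thinning is phrased for sets of pairs rather than for a map \<open>\<sigma>\<close>, since sets of pairs can be
  reversed: this turns the case where the values of \<open>\<sigma>\<close> stay bounded into the case where its
  arguments do.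
\<close>
definition separated_pairs :: "('a \<times> 'a) set \<Rightarrow> bool" where
  "separated_pairs Q \<longleftrightarrow> infinite Q \<and> Domain Q \<inter> Range Q = {} \<and>
     asymptotically_separated X \<E> (Domain Q) (Range Q)"

definition unbounded_pairs :: "('a \<times> 'a) set \<Rightarrow> bool" where
  "unbounded_pairs Q \<longleftrightarrow> (\<forall>r. \<exists>(x, y)\<in>Q. r < d x y)"

lemma unbounded_pairs_infinite: "unbounded_pairs Q \<Longrightarrow> infinite Q"
proof
  assume unb: "unbounded_pairs Q" and "finite Q"
  then have "bdd_above ((\<lambda>(x, y). d x y) ` Q)"
    by simp
  then obtain r where "\<And>x y. (x, y) \<in> Q \<Longrightarrow> d x y \<le> r"
    by (fastforce simp: bdd_above_def)
  moreover obtain x y where "(x, y) \<in> Q" "r < d x y"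
    using unb unfolding unbounded_pairs_def by blast
  ultimately show False
    by force
qed

lemma separated_pairs_converse: "separated_pairs (Q\<inverse>) \<longleftrightarrow> separated_pairs Q"
  unfolding separated_pairs_def using asymptotically_separated_sym by auto

lemma unbounded_pairs_converse: "unbounded_pairs (Q\<inverse>) \<longleftrightarrow> unbounded_pairs Q"
  unfolding unbounded_pairs_def by (auto simp: commute Bex_def) (metis commute)+

text \<open>
  If arbitrarily distant pairs have their first entry in one ball, those among them whose
  second entry is outside that ball will do: the first entries form a bounded set.
\<close>
lemma separated_pairs_bounded_side:
  assumes "o' \<in> X" and "Q \<subseteq> X \<times> X" and unb: "unbounded_pairs {(x, y) \<in> Q. d o' x \<le> r}"
  shows "\<exists>Q'\<subseteq>Q. separated_pairs Q'"
proof -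
  let ?Q = "{(x, y) \<in> Q. d o' x \<le> r \<and> r < d o' y}"
  have "unbounded_pairs ?Q"
    unfolding unbounded_pairs_def
  proof
    fix s
    \<comment> \<open>A distance above \<open>2 * r\<close> forces the second entry out of the ball of radius \<open>r\<close>.\<close>
    obtain x y where xy: "(x, y) \<in> Q" "d o' x \<le> r" "max s (2 * r) < d x y"
      using unb unfolding unbounded_pairs_def by (fastforce dest: spec[of _ "max s (2 * r)"])
    then have "d x y \<le> d o' x + d o' y"
      using assms triangle[of x o' y] commute[of x o'] by auto
    with xy show "\<exists>(x, y)\<in>?Q. s < d x y"
      by (intro bexI[of _ "(x, y)"]) auto
  qed
  then have "infinite ?Q"
    by (rule unbounded_pairs_infinite)
  moreover have "Domain ?Q \<inter> Range ?Q = {}"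
    by force
  moreover have "asymptotically_separated X \<E> (Domain ?Q) (Range ?Q)"
    by (rule asymptotically_separated_bounded[OF assms(1), of _ r]) (use assms(2) in auto)
  ultimately show ?thesis
    unfolding separated_pairs_def by (intro exI[of _ ?Q]) auto
qed

text \<open>
  If the pairs can be taken with both entries far from \<open>o'\<close>, they are chosen one after the other,
  each one so much farther out than its predecessors that its entries are far from all
  earlier entries. The entries \<open>x\<^sub>i\<close> and \<open>y\<^sub>j\<close> are then more than \<open>max i j\<close> apart, so a
  neighbourhood of fixed radius of both sets involves only finitely many \<open>x\<^sub>i\<close>.
\<close>
lemma separated_pairs_escaping:
  assumes "o' \<in> X" and "Q \<subseteq> X \<times> X"
    and esc: "\<And>r. \<exists>(x, y)\<in>Q. r < d x y \<and> r < d o' x \<and> r < d o' y"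
  shows "\<exists>Q'\<subseteq>Q. separated_pairs Q'"
proof -
  define m where "m p = min (d o' (fst p)) (d o' (snd p))" for p
  define b where "b p = max (d o' (fst p)) (d o' (snd p))" for p
  \<comment> \<open>\<open>m p\<close> and \<open>b p\<close> are the distances from \<open>o'\<close> to the nearer and to the farther entry of \<open>p\<close>.\<close>
  have esc': "\<exists>p. p \<in> Q \<and> r < d (fst p) (snd p) \<and> r < m p" for r
    using esc[of r] unfolding m_def by force
  have "\<exists>p::nat \<Rightarrow> _. \<forall>n. (p n \<in> Q \<and> real n < d (fst (p n)) (snd (p n))) \<and>
          b (p n) + real (Suc n) < m (p (Suc n))"
  proof (rule dependent_nat_choice)
    show "\<exists>p. p \<in> Q \<and> real 0 < d (fst p) (snd p)"
      using esc'[of "real 0"] by blast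
    show "\<exists>q. (q \<in> Q \<and> real (Suc n) < d (fst q) (snd q)) \<and> b p + real (Suc n) < m q" for p n
      using esc'[of "max (real (Suc n)) (b p + real (Suc n))"] by auto
  qed
  then obtain p :: "nat \<Rightarrow> _" where
    p: "\<And>n. p n \<in> Q" "\<And>n. real n < d (fst (p n)) (snd (p n))"
      "\<And>n. b (p n) + real (Suc n) < m (p (Suc n))"
    by blast
  have X: "fst (p n) \<in> X" "snd (p n) \<in> X" for n
    using p(1)[of n] assms(2) by auto
  have gap: "b (p k) + real n < m (p n)" if "k < n" for k n
    using that
  proof (induction n)
    case (Suc n)
    have "b (p k) \<le> b (p n)"
    proof (cases "k = n")
      case False
      with Suc have "b (p k) + real n < m (p n)"
        by simp
      then show ?thesis
        unfolding m_def b_def by linarith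
    qed simp
    with p(3)[of n] show ?case
      by linarith
  qed simp
  have far: "real (max i j) < d (fst (p i)) (snd (p j))" for i j
  proof (cases i j rule: linorder_cases)
    case less
    then show ?thesis
      using gap[OF less] X[of i] X[of j] assms(1) triangle[of o' "fst (p i)" "snd (p j)"]
      unfolding m_def b_def by auto
  next
    case equal
    then show ?thesis
      using p(2) by simp
  next
    case greater
    then show ?thesis
      using gap[OF greater] X[of i] X[of j] assms(1) triangle[of o' "snd (p j)" "fst (p i)"]
        commute[of "fst (p i)" "snd (p j)"]
      unfolding m_def b_def by auto
  qed
  let ?Q = "range p"
  have "\<exists>(x, y)\<in>?Q. r < d x y" for r
  proof -
    obtain n where "r < real n"
      using reals_Archimedean2 by blast
    then have "r < d (fst (p n)) (snd (p n))"
      using p(2)[of n] by linarith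
    then show ?thesis
      by (intro bexI[of _ "p n"]) (auto simp: case_prod_unfold)
  qed
  then have "infinite ?Q"
    by (intro unbounded_pairs_infinite) (simp add: unbounded_pairs_def)
  moreover have "Domain ?Q \<inter> Range ?Q = {}"
  proof -
    have "fst (p i) \<noteq> snd (p j)" for i j
      using far[of i j] X[of i] by (metis mdist_zero not_less of_nat_0_le_iff)
    then show ?thesis
      by (auto simp: Domain_fst Range_snd)
  qed
  moreover have "asymptotically_separated X \<E> (Domain ?Q) (Range ?Q)"
    unfolding asymptotically_separated_def
  proof
    fix E assume "E \<in> \<E>"
    then obtain s where s: "\<And>x y. (x, y) \<in> E \<Longrightarrow> x \<in> X \<and> y \<in> X \<and> d x y \<le> s"
      by (rule entourage_bound) blast
    obtain N :: nat where N: "2 * s < real N"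
      using reals_Archimedean2 by blast
    define r where "r = (\<Sum>n<N. d o' (fst (p n)))"
    show "coarse_bounded X \<E> (E `` Domain ?Q \<inter> E `` Range ?Q)"
    proof (rule coarse_boundedI[OF assms(1)])
      show "E `` Domain ?Q \<inter> E `` Range ?Q \<subseteq> X"
        using s by blast
      fix z assume "z \<in> E `` Domain ?Q \<inter> E `` Range ?Q"
      then obtain i j where ij: "(fst (p i), z) \<in> E" "(snd (p j), z) \<in> E"
        by (auto simp: Domain_fst Range_snd)
      then have "d (fst (p i)) (snd (p j)) \<le> 2 * s"
        using s[OF ij(1)] s[OF ij(2)] triangle[of "fst (p i)" z "snd (p j)"] commute[of z "snd (p j)"]
        by auto
      then have "i < N"
        using far[of i j] N by simp
      then have "d o' (fst (p i)) \<le> r"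
        unfolding r_def by (intro member_le_sum) auto
      then show "d o' z \<le> r + s"
        using s[OF ij(1)] assms(1) triangle[of o' "fst (p i)" z] by auto
    qed
  qed
  ultimately show ?thesis
    unfolding separated_pairs_def using p(1) by (intro exI[of _ ?Q]) auto
qed

text \<open>
  Either the distances stay unbounded on the pairs with one entry in some fixed ball, or
  discarding the pairs that meet a given ball leaves the distances unbounded, whatever the ball.
\<close>
lemma unbounded_pairs_imp_separated_pairs:
  assumes "Q \<subseteq> X \<times> X" and unb: "unbounded_pairs Q"
  shows "\<exists>Q'\<subseteq>Q. separated_pairs Q'"
proof -
  obtain o' where o': "o' \<in> X"
    using assms unfolding unbounded_pairs_def by fastforce
  consider (left) r where "unbounded_pairs {(x, y) \<in> Q. d o' x \<le> r}"
    | (right) r where "unbounded_pairs {(x, y) \<in> Q. d o' y \<le> r}"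
    | (escaping) "\<And>r. \<not> unbounded_pairs {(x, y) \<in> Q. d o' x \<le> r}"
        "\<And>r. \<not> unbounded_pairs {(x, y) \<in> Q. d o' y \<le> r}"
    by blast
  then show ?thesis
  proof cases
    case left
    then show ?thesis
      by (rule separated_pairs_bounded_side[OF o' assms(1)])
  next
    case right
    have "{(x, y) \<in> Q\<inverse>. d o' x \<le> r} = {(x, y) \<in> Q. d o' y \<le> r}\<inverse>"
      by auto
    then have "unbounded_pairs {(x, y) \<in> Q\<inverse>. d o' x \<le> r}"
      using right by (simp only: unbounded_pairs_converse)
    then obtain Q' where "Q' \<subseteq> Q\<inverse>" "separated_pairs Q'"
      using separated_pairs_bounded_side[OF o', of "Q\<inverse>" r] assms(1) by blast
    then show ?thesis
      using separated_pairs_converse by (intro exI[of _ "Q'\<inverse>"]) auto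
  next
    case escaping
    have "\<exists>(x, y)\<in>Q. r < d x y \<and> r < d o' x \<and> r < d o' y" for r
    proof -
      obtain s where s: "\<And>x y. (x, y) \<in> Q \<Longrightarrow> d o' x \<le> r \<Longrightarrow> d x y \<le> s"
        using escaping(1)[of r] unfolding unbounded_pairs_def by (auto simp: not_less)
      obtain t where t: "\<And>x y. (x, y) \<in> Q \<Longrightarrow> d o' y \<le> r \<Longrightarrow> d x y \<le> t"
        using escaping(2)[of r] unfolding unbounded_pairs_def by (auto simp: not_less)
      obtain x y where "(x, y) \<in> Q" "max r (max s t) < d x y"
        using unb unfolding unbounded_pairs_def by (fastforce dest: spec[of _ "max r (max s t)"])
      then show ?thesis
        using s[of x y] t[of x y] by (intro bexI[of _ "(x, y)"]) force+
    qed
    then show ?thesis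
      by (rule separated_pairs_escaping[OF o' assms(1)])
  qed
qed

text \<open>
  The hypothesis \<open>finite\<close> is the property of the members of the permutation group established in
  \<open>permutation_group_displacement\<close>; a function separating the two sides of infinitely many pairs
  \<open>(x, \<sigma> x)\<close> violates it for \<open>\<epsilon>\<close> the distance of the two images.
\<close>
lemma M_normal_displacement_bounded:
  assumes "M_normal M X \<E>" and "\<sigma> \<in> X \<rightarrow> X"
    and finite: "\<And>f \<epsilon>. f \<in> so M X \<E> \<Longrightarrow> \<epsilon> > 0 \<Longrightarrow> finite {x \<in> X. \<epsilon> \<le> dist (f x) (f (\<sigma> x))}"
  obtains r where "\<And>x. x \<in> X \<Longrightarrow> d x (\<sigma> x) \<le> r"
proof (rule ccontr)
  let ?Q = "(\<lambda>x. (x, \<sigma> x)) ` X"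
  assume "\<not> thesis"
  then have "\<exists>x\<in>X. r < d x (\<sigma> x)" for r
    using that by (meson not_less)
  then have "unbounded_pairs ?Q"
    unfolding unbounded_pairs_def by simp
  then obtain Q where Q: "Q \<subseteq> ?Q" "separated_pairs Q"
    using unbounded_pairs_imp_separated_pairs[of ?Q] assms(2) by auto
  then have Q_sep: "infinite Q" "Domain Q \<inter> Range Q = {}"
    "asymptotically_separated X \<E> (Domain Q) (Range Q)"
    unfolding separated_pairs_def by auto
  have Q_eq: "Q = (\<lambda>x. (x, \<sigma> x)) ` Domain Q"
    using Q(1) by force
  then have "infinite (Domain Q)"
    using Q_sep(1) by (metis finite_imageI)
  have "Domain Q \<subseteq> X" "Range Q \<subseteq> X"
    using Q(1) assms(2) by blast+
  moreover have "Q \<noteq> {}"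
    using Q_sep(1) by auto
  then have "Domain Q \<noteq> {}" "Range Q \<noteq> {}"
    by auto
  ultimately obtain f where f: "f \<in> so M X \<E>"
    and pos: "Inf {dist (f a) (f b) | a b. a \<in> Domain Q \<and> b \<in> Range Q} > 0" (is "Inf ?D > 0")
    using assms(1) Q_sep(2,3) unfolding M_normal_def by meson
  have "Inf ?D \<le> dist (f x) (f (\<sigma> x))" if "x \<in> Domain Q" for x
  proof (rule cInf_lower)
    have "(x, \<sigma> x) \<in> Q"
      using that Q_eq by blast
    then show "dist (f x) (f (\<sigma> x)) \<in> ?D"
      by blast
    show "bdd_below ?D"
      by (rule bdd_belowI[of _ 0]) auto
  qed
  then have "Domain Q \<subseteq> {x \<in> X. Inf ?D \<le> dist (f x) (f (\<sigma> x))}"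
    using \<open>Domain Q \<subseteq> X\<close> by blast
  with finite[OF f pos] \<open>infinite (Domain Q)\<close> show False
    using finite_subset by blast
qed

lemma action_subset_if_displacements_bounded:
  assumes "\<And>\<sigma>. \<sigma> \<in> G \<Longrightarrow> \<exists>r. \<forall>x\<in>X. d x (\<sigma> x) \<le> r"
  shows "action_coarse_structure X G \<subseteq> \<E>"
proof
  fix E assume "E \<in> action_coarse_structure X G"
  then obtain F where ent: "entourage X E" and F: "finite F" "F \<subseteq> G" "E \<subseteq> action_entourage X F"
    unfolding action_coarse_structure_def by blast
  obtain r where r: "\<And>\<sigma> x. \<sigma> \<in> F \<Longrightarrow> x \<in> X \<Longrightarrow> d x (\<sigma> x) \<le> r \<sigma>"
    using assms F(2) by (metis subsetD)
  obtain n :: nat where n: "Max (insert 0 (r ` F)) \<le> real n"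
    using real_arch_simple by blast
  have "d x y \<le> real n" if "(x, y) \<in> E" for x y
  proof -
    have "x \<in> X" "y = x \<or> (\<exists>\<sigma>\<in>F. y = \<sigma> x)"
      using that F(3) unfolding action_entourage_def by auto
    then show ?thesis
    proof (elim disjE bexE)
      fix \<sigma> assume \<sigma>: "\<sigma> \<in> F" "y = \<sigma> x"
      then have "r \<sigma> \<le> Max (insert 0 (r ` F))"
        using F(1) by (intro Max_ge) auto
      with r[OF \<sigma>(1) \<open>x \<in> X\<close>] n show ?thesis
        unfolding \<sigma>(2) by linarith
    qed simp
  qed
  then show "E \<in> \<E>"
    unfolding \<E>_eq using ent by blast
qed

end


section \<open>The coarse structure of a compactification\<close>

theorem theorem5p1:
  fixes M :: "'m::metric_space itself"
    and X :: "'a set"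
    and \<E> :: "('a \<times> 'a) set set"
  assumes "proper_metric_space M"
    and "coarse_space X \<E>"
  shows "let K = M_compactification M X \<E>;
             G = pullback_permutations X (M_embedding M X \<E>) (permutation_group K);
             \<E>\<^sub>G = action_coarse_structure X G
         in (finitary X \<E> \<longrightarrow> \<E> \<subseteq> \<E>\<^sub>G) \<and>
            (coarsely_metrizable X \<E> \<and> M_normal M X \<E> \<longrightarrow> \<E>\<^sub>G \<subseteq> \<E>) \<and>
            (finitary X \<E> \<and> coarsely_metrizable X \<E> \<and> M_normal M X \<E> \<longrightarrow> \<E> = \<E>\<^sub>G)"
proof -
  interpret coarse_compactification M X \<E>
    using assms by unfold_locales
  let ?G = "pullback_permutations X \<delta> (permutation_group K)"
  have "action_coarse_structure X ?G \<subseteq> \<E>" if "coarsely_metrizable X \<E>" and normal: "M_normal M X \<E>"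
  proof -
    obtain d where "Metric_space X d"
      and "\<E> = {E. entourage X E \<and> (\<exists>n::nat. E \<subseteq> {(x, y). d x y \<le> real n})}"
      using \<open>coarsely_metrizable X \<E>\<close> unfolding coarsely_metrizable_def by blast
    then interpret metric_coarse_structure X d \<E>
      by (simp add: metric_coarse_structure_def metric_coarse_structure_axioms_def)
    show ?thesis
    proof (rule action_subset_if_displacements_bounded)
      fix \<sigma> assume \<sigma>: "\<sigma> \<in> ?G"
      then have "\<sigma> \<in> X \<rightarrow> X"
        by (auto simp: pullback_permutations_def)
      then show "\<exists>r. \<forall>x\<in>X. d x (\<sigma> x) \<le> r"
        using M_normal_displacement_bounded[OF normal _ permutation_group_displacement[OF \<sigma>]] by metis
    qed
  qed
  then show ?thesis
    using finitary_imp_subset_action unfolding Let_def by blast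
qed

end
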